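(* Let $G$ and $H$ be graphs with orders $N_1,N_2$ and edge counts $s_G,s_H$, and let $G\vee H$ be their join. Then $$\mathcal E(G)+\mathcal E(H)-2\sqrt{N_1N_2}\leq\mathcal E(G\vee H)\leq\mathcal E(G)+\mathcal E(H)+2\sqrt{N_1N_2}.$$ Consequently, $$\operatorname{FR}_{\min}(G\vee H)\geq\frac{\max\{0,\mathcal E(G)+\mathcal E(H)-2\sqrt{N_1N_2}\}}{\sqrt{2(s_G+s_H+N_1N_2)}}.$$
   Context: Graphs are finite, simple and undirected, with nonempty vertex set. If $G$ and $H$ have disjoint vertex sets, their join $G\vee H$ is obtained from their disjoint union by adding every edge between $V(G)$ and $V(H)$. A vertex labeling of a graph $G=(V,E)$ of order $N=|V|$ is a bijection $\sigma:V\to\mathbb Z_N=\mathbb Z/N\mathbb Z$. The adjacency matrix under $\sigma$ is the $N\times N$ matrix $A_\sigma$, indexed by $\mathbb Z_N\times\mathbb Z_N$, with $(A_\sigma)_{x,y}=1$ if the vertices labeled $x$ and $y$ are adjacent and $0$ otherwise. $F$ is the unitary Fourier matrix $F_{mx}=\frac1{\sqrt N}e^{-2\pi i mx/N}$. The Fourier ratio of a nonzero $N\times N$ matrix $M$ is $\operatorname{FR}(M)=\|FMF\|_1/\|FMF\|_2$, where $\|\cdot\|_1$ is the entrywise $\ell^1$-norm and $\|\cdot\|_2$ the Frobenius norm. The edge complexity of a graph with at least one edge is $\operatorname{FR}_{\min}(G)=\min_\sigma\operatorname{FR}(A_\sigma)$, the minimum over all vertex labelings. The graph energy $\mathcal E(G)$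 is the sum of the absolute values of the adjacency eigenvalues counted with multiplicity. *)

theory Defs
  imports
    "Graph_Theory.Pair_Digraph"
    "Jordan_Normal_Form.Spectral_Radius"
begin

text \<open>
  A finite simple undirected graph is a \<open>pair_graph\<close>: a finite, loop-free, symmetric relation
  \<open>parcs G\<close> on a finite vertex set \<open>pverts G\<close>. Every undirected edge gives two arcs, so edges are
  counted as unordered pairs. A \<open>pair_graph\<close> may have no vertices; the condition that the vertex
  set is nonempty has to be assumed separately.
\<close>

definition order_of :: "'a pair_pre_digraph \<Rightarrow> nat" where
  "order_of G = card (pverts G)"

definition edge_set :: "'a pair_pre_digraph \<Rightarrow> 'a set set" where
  "edge_set G = {{u, v} | u v. (u, v) \<in> parcs G}"

definition edge_count :: "'a pair_pre_digraph \<Rightarrow> nat" where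
  "edge_count G = card (edge_set G)"

text \<open>The join is meant for graphs with disjoint vertex sets.\<close>

definition graph_join :: "'a pair_pre_digraph \<Rightarrow> 'a pair_pre_digraph \<Rightarrow> 'a pair_pre_digraph" where
  "graph_join G H =
     \<lparr> pverts = pverts G \<union> pverts H,
       parcs = parcs G \<union> parcs H \<union> (pverts G \<times> pverts H) \<union> (pverts H \<times> pverts G) \<rparr>"

lemma pair_graph_join:
  assumes G: "pair_graph G" and H: "pair_graph H" and disj: "pverts G \<inter> pverts H = {}"
  shows "pair_graph (graph_join G H)"
proof -
  interpret G: pair_graph G by (rule G)
  interpret H: pair_graph H by (rule H)
  have sG: "(u, v) \<in> parcs G \<Longrightarrow> (v, u) \<in> parcs G" for u v
    using G.pair_sym_arcs unfolding symmetric_def sym_def by simp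
  have sH: "(u, v) \<in> parcs H \<Longrightarrow> (v, u) \<in> parcs H" for u v
    using H.pair_sym_arcs unfolding symmetric_def sym_def by simp
  show ?thesis
  proof
    fix e assume e: "e \<in> parcs (graph_join G H)"
    show "fst e \<in> pverts (graph_join G H)" "snd e \<in> pverts (graph_join G H)"
      using e G.arc_fst_in_verts G.arc_snd_in_verts H.arc_fst_in_verts H.arc_snd_in_verts
      by (auto simp: graph_join_def)
    show "fst e \<noteq> snd e"
      using e G.pair_no_loops H.pair_no_loops disj by (auto simp: graph_join_def)
  next
    show "finite (pverts (graph_join G H))" "finite (parcs (graph_join G H))"
      using G.pair_finite_verts H.pair_finite_verts G.pair_finite_arcs H.pair_finite_arcs
      by (auto simp: graph_join_def)
    show "symmetric (with_proj (graph_join G H))"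
      using sG sH unfolding symmetric_def sym_def by (auto simp: graph_join_def)
  qed
qed

text \<open>The residues modulo \<open>N\<close> are represented by \<open>{0..<N}\<close>, the index range of an \<open>N \<times> N\<close> matrix.\<close>

definition vertex_labeling :: "'a pair_pre_digraph \<Rightarrow> ('a \<Rightarrow> nat) \<Rightarrow> bool" where
  "vertex_labeling G \<sigma> \<longleftrightarrow> bij_betw \<sigma> (pverts G) {0..<order_of G}"

definition adj_matrix :: "'a pair_pre_digraph \<Rightarrow> ('a \<Rightarrow> nat) \<Rightarrow> complex mat" where
  "adj_matrix G \<sigma> = mat (order_of G) (order_of G)
     (\<lambda>(x, y). if (inv_into (pverts G) \<sigma> x, inv_into (pverts G) \<sigma> y) \<in> parcs G then 1 else 0)"

definition fourier_matrix :: "nat \<Rightarrow> complex mat" where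
  "fourier_matrix N = mat N N
     (\<lambda>(m, x). exp (- (2 * of_real pi * \<i> * of_nat m * of_nat x / of_nat N)) / of_real (sqrt (real N)))"

definition entry_l1_norm :: "complex mat \<Rightarrow> real" where
  "entry_l1_norm M = (\<Sum>i<dim_row M. \<Sum>j<dim_col M. cmod (M $$ (i, j)))"

definition frobenius_norm :: "complex mat \<Rightarrow> real" where
  "frobenius_norm M = sqrt (\<Sum>i<dim_row M. \<Sum>j<dim_col M. (cmod (M $$ (i, j)))\<^sup>2)"

text \<open>For square nonzero \<open>M\<close>; on the zero matrix the value is \<open>0\<close> by the convention \<open>0 / 0 = 0\<close>.\<close>

definition fourier_ratio :: "complex mat \<Rightarrow> real" where
  "fourier_ratio M =
     (let F = fourier_matrix (dim_row M); T = F * M * F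
      in entry_l1_norm T / frobenius_norm T)"

definition FR_min :: "'a pair_pre_digraph \<Rightarrow> real" where
  "FR_min G = Min {fourier_ratio (adj_matrix G \<sigma>) | \<sigma>. vertex_labeling G \<sigma>}"

text \<open>
  A labeling is a total function, arbitrary outside \<open>pverts G\<close>, so there may be infinitely many of
  them. They yield only finitely many adjacency matrices, so that \<^const>\<open>FR_min\<close> is a minimum.
\<close>

lemma vertex_labeling_exists:
  assumes "finite (pverts G)"
  shows "\<exists>\<sigma>. vertex_labeling G \<sigma>"
  using ex_bij_betw_finite_nat[OF assms] by (simp add: vertex_labeling_def order_of_def)

lemma FR_min_attained:
  assumes "finite (pverts G)"
  shows "finite {fourier_ratio (adj_matrix G \<sigma>) | \<sigma>. vertex_labeling G \<sigma>}"
    and "{fourier_ratio (adj_matrix G \<sigma>) | \<sigma>. vertex_labeling G \<sigma>} \<noteq> {}"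
proof -
  let ?N = "order_of G"
  let ?I = "{0..<?N} \<times> {0..<?N}"
  let ?g = "\<lambda>S. fourier_ratio (mat ?N ?N (\<lambda>p. if p \<in> S then 1 else 0))"
  have "{fourier_ratio (adj_matrix G \<sigma>) | \<sigma>. vertex_labeling G \<sigma>} \<subseteq> ?g ` Pow ?I"
  proof
    fix r assume "r \<in> {fourier_ratio (adj_matrix G \<sigma>) | \<sigma>. vertex_labeling G \<sigma>}"
    then obtain \<sigma> where r: "r = fourier_ratio (adj_matrix G \<sigma>)" by auto
    let ?S = "{(x, y) \<in> ?I. (inv_into (pverts G) \<sigma> x, inv_into (pverts G) \<sigma> y) \<in> parcs G}"
    have "adj_matrix G \<sigma> = mat ?N ?N (\<lambda>p. if p \<in> ?S then 1 else 0)"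
      by (rule eq_matI) (auto simp: adj_matrix_def)
    with r have "r = ?g ?S" by simp
    then show "r \<in> ?g ` Pow ?I" by blast
  qed
  then show "finite {fourier_ratio (adj_matrix G \<sigma>) | \<sigma>. vertex_labeling G \<sigma>}"
    by (rule finite_subset) simp
  show "{fourier_ratio (adj_matrix G \<sigma>) | \<sigma>. vertex_labeling G \<sigma>} \<noteq> {}"
    using vertex_labeling_exists[OF assms] by auto
qed

text \<open>Multiplicity is algebraic: the order of the eigenvalue as a root of the characteristic polynomial.\<close>

definition matrix_energy :: "complex mat \<Rightarrow> real" where
  "matrix_energy A = (\<Sum>\<mu>\<in>spectrum A. real (order \<mu> (char_poly A)) * cmod \<mu>)"

text \<open>The choice of labeling is immaterial, by \<open>graph_energy_eq\<close> below.\<close>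

definition graph_energy :: "'a pair_pre_digraph \<Rightarrow> real" where
  "graph_energy G = matrix_energy (adj_matrix G (SOME \<sigma>. vertex_labeling G \<sigma>))"

lemma similar_adj_matrix:
  assumes s: "vertex_labeling G \<sigma>" and t: "vertex_labeling G \<tau>"
  shows "similar_mat (adj_matrix G \<sigma>) (adj_matrix G \<tau>)"
proof -
  let ?N = "order_of G"
  let ?V = "pverts G"
  let ?A = "adj_matrix G \<sigma>" and ?B = "adj_matrix G \<tau>"
  have bs: "bij_betw \<sigma> ?V {0..<?N}" and bt: "bij_betw \<tau> ?V {0..<?N}"
    using s t by (auto simp: vertex_labeling_def)
  define p where "p = (\<lambda>x. \<tau> (inv_into ?V \<sigma> x))"
  define q where "q = (\<lambda>x. \<sigma> (inv_into ?V \<tau> x))"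
  have iS: "inv_into ?V \<sigma> x \<in> ?V" "\<sigma> (inv_into ?V \<sigma> x) = x" if "x < ?N" for x
    using bs that by (auto simp: bij_betw_def intro: inv_into_into f_inv_into_f)
  have iT: "inv_into ?V \<tau> x \<in> ?V" "\<tau> (inv_into ?V \<tau> x) = x" if "x < ?N" for x
    using bt that by (auto simp: bij_betw_def intro: inv_into_into f_inv_into_f)
  have iS': "inv_into ?V \<sigma> (\<sigma> v) = v" "\<sigma> v < ?N" if "v \<in> ?V" for v
    using bs that by (auto simp: bij_betw_def)
  have iT': "inv_into ?V \<tau> (\<tau> v) = v" "\<tau> v < ?N" if "v \<in> ?V" for v
    using bt that by (auto simp: bij_betw_def)
  have p: "p x < ?N" "q (p x) = x" if "x < ?N" for x
    using that by (auto simp: p_def q_def iS iT iS' iT')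
  have q: "q x < ?N" "p (q x) = x" if "x < ?N" for x
    using that by (auto simp: p_def q_def iS iT iS' iT')
  have pq: "y = p x \<longleftrightarrow> x = q y" if "x < ?N" "y < ?N" for x y
    using p q that by metis
  define P where "P = (mat ?N ?N (\<lambda>(x, y). if y = p x then 1 else 0) :: complex mat)"
  define Q where "Q = (mat ?N ?N (\<lambda>(x, y). if y = q x then 1 else 0) :: complex mat)"
  have AB: "?A $$ (x, y) = ?B $$ (p x, p y)" if "x < ?N" "y < ?N" for x y
    using that p by (simp add: adj_matrix_def) (simp add: p_def iS iT')
  have P_mult: "(P * M) $$ (x, y) = M $$ (p x, y)"
    if "M \<in> carrier_mat ?N ?N" "x < ?N" "y < ?N" for M x y
    using that p
    by (auto simp: P_def scalar_prod_def if_distrib[of "\<lambda>c. c * _"] cong: if_cong)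
  have Q_mult: "(Q * M) $$ (x, y) = M $$ (q x, y)"
    if "M \<in> carrier_mat ?N ?N" "x < ?N" "y < ?N" for M x y
    using that q
    by (auto simp: Q_def scalar_prod_def if_distrib[of "\<lambda>c. c * _"] cong: if_cong)
  have mult_Q: "(M * Q) $$ (x, y) = M $$ (x, p y)"
    if "M \<in> carrier_mat ?N ?N" "x < ?N" "y < ?N" for M x y
  proof -
    have "(M * Q) $$ (x, y) = (\<Sum>k = 0..<?N. M $$ (x, k) * (if y = q k then 1 else 0))"
      using that by (auto simp: Q_def scalar_prod_def)
    also have "\<dots> = (\<Sum>k = 0..<?N. if k = p y then M $$ (x, k) else 0)"
      by (rule sum.cong) (use that pq in auto)
    finally show ?thesis using that p by simp
  qed
  have carr: "{?A, ?B, P, Q} \<subseteq> carrier_mat ?N ?N"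
    by (auto simp: adj_matrix_def P_def Q_def)
  have "P * Q = 1\<^sub>m ?N"
  proof (rule eq_matI)
    fix x y assume "x < dim_row (1\<^sub>m ?N :: complex mat)" "y < dim_col (1\<^sub>m ?N :: complex mat)"
    then have xy: "x < ?N" "y < ?N" by auto
    have "(P * Q) $$ (x, y) = Q $$ (p x, y)"
      by (rule P_mult) (use carr xy in auto)
    also have "\<dots> = 1\<^sub>m ?N $$ (x, y)"
      using xy p[OF xy(1)] by (auto simp: Q_def)
    finally show "(P * Q) $$ (x, y) = 1\<^sub>m ?N $$ (x, y)" .
  qed (use carr in auto)
  moreover have "Q * P = 1\<^sub>m ?N"
  proof (rule eq_matI)
    fix x y assume "x < dim_row (1\<^sub>m ?N :: complex mat)" "y < dim_col (1\<^sub>m ?N :: complex mat)"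
    then have xy: "x < ?N" "y < ?N" by auto
    have "(Q * P) $$ (x, y) = P $$ (q x, y)"
      by (rule Q_mult) (use carr xy in auto)
    also have "\<dots> = 1\<^sub>m ?N $$ (x, y)"
      using xy q[OF xy(1)] by (auto simp: P_def)
    finally show "(Q * P) $$ (x, y) = 1\<^sub>m ?N $$ (x, y)" .
  qed (use carr in auto)
  moreover have "?A = P * ?B * Q"
  proof (rule eq_matI)
    fix x y assume "x < dim_row (P * ?B * Q)" "y < dim_col (P * ?B * Q)"
    then have xy: "x < ?N" "y < ?N" using carr by auto
    have PB: "P * ?B \<in> carrier_mat ?N ?N" using carr by auto
    show "?A $$ (x, y) = (P * ?B * Q) $$ (x, y)"
    proof -
      have "(P * ?B * Q) $$ (x, y) = (P * ?B) $$ (x, p y)"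
        using xy by (rule mult_Q[OF PB])
      also have "\<dots> = ?B $$ (p x, p y)"
        by (rule P_mult) (use carr xy p in auto)
      also have "\<dots> = ?A $$ (x, y)"
        using AB xy by simp
      finally show ?thesis by simp
    qed
  qed (use carr in auto)
  ultimately show ?thesis
    using carr by (intro similar_matI)
qed

lemma matrix_energy_char_poly:
  assumes A: "A \<in> carrier_mat n n" and B: "B \<in> carrier_mat n n" and eq: "char_poly A = char_poly B"
  shows "matrix_energy A = matrix_energy B"
proof -
  have "spectrum A = spectrum B"
    using eq by (auto simp: spectrum_def eigenvalue_root_char_poly[OF A] eigenvalue_root_char_poly[OF B])
  with eq show ?thesis by (simp add: matrix_energy_def)
qed

lemma graph_energy_eq:
  assumes "vertex_labeling G \<sigma>"
  shows "graph_energy G = matrix_energy (adj_matrix G \<sigma>)"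
proof -
  have "vertex_labeling G (SOME \<sigma>. vertex_labeling G \<sigma>)"
    using assms by (rule someI[of "vertex_labeling G"])
  from char_poly_similar[OF similar_adj_matrix[OF this assms]] show ?thesis
    unfolding graph_energy_def
    by (rule matrix_energy_char_poly[of _ "order_of G", rotated 2]) (auto simp: adj_matrix_def)
qed

end

theory Submission
  imports Defs "HOL-Analysis.Convex"
begin

text \<open>
  For Hermitian \<open>A\<close> the energy is the trace norm: the maximum of \<open>\<bar>tr (U A)\<bar>\<close> over unitary \<open>U\<close>, as
  one sees by diagonalizing \<open>A\<close>. The adjacency matrix of the join differs from
  \<open>diag(A\<^sub>G, A\<^sub>H)\<close> only in two all-ones blocks, and by Cauchy--Schwarz each of these contributes at
  most \<open>\<surd>(N\<^sub>1 N\<^sub>2)\<close> to \<open>tr (U A)\<close>. For the Fourier ratio, write \<open>A = F\<^sup>* (F A F) F\<^sup>*\<close> with \<open>F\<close>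
  unitary: then \<open>tr (U A) = tr (W (F A F))\<close> with \<open>W\<close> unitary, whose entries are bounded by 1, so the
  energy is at most the \<open>l\<^sup>1\<close>-norm of \<open>F A F\<close>, while the Frobenius norm of \<open>F A F\<close> is that of \<open>A\<close>.
\<close>

section \<open>Adjoints, unitary matrices and traces\<close>

lemma mat_adjoint_index [simp]:
  "i < dim_col A \<Longrightarrow> j < dim_row A \<Longrightarrow> mat_adjoint A $$ (i, j) = conjugate (A $$ (j, i))"
  by (simp add: mat_adjoint_def mat_of_rows_index)

lemma mat_adjoint_dim [simp]:
  "dim_row (mat_adjoint A) = dim_col A" "dim_col (mat_adjoint A) = dim_row A"
  by (simp_all add: mat_adjoint_def)

lemma mat_adjoint_carrier [simp]: "A \<in> carrier_mat n m \<Longrightarrow> mat_adjoint A \<in> carrier_mat m n"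
  by (metis carrier_matD carrier_matI mat_adjoint_dim)

lemma mat_adjoint_adjoint [simp]: "mat_adjoint (mat_adjoint A) = A"
  by (rule eq_matI) auto

lemma mat_adjoint_zero [simp]: "mat_adjoint (0\<^sub>m n m :: complex mat) = 0\<^sub>m m n"
  by (rule eq_matI) auto

lemma mat_adjoint_one [simp]: "mat_adjoint (1\<^sub>m n :: complex mat) = 1\<^sub>m n"
  by (rule eq_matI) auto

lemma mat_adjoint_mult:
  fixes A B :: "complex mat"
  assumes "A \<in> carrier_mat n m" "B \<in> carrier_mat m k"
  shows "mat_adjoint (A * B) = mat_adjoint B * mat_adjoint A"
proof (rule eq_matI)
  fix i j assume "i < dim_row (mat_adjoint B * mat_adjoint A)"
    and "j < dim_col (mat_adjoint B * mat_adjoint A)"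
  then show "mat_adjoint (A * B) $$ (i, j) = (mat_adjoint B * mat_adjoint A) $$ (i, j)"
    using assms by (auto simp: scalar_prod_def mult.commute intro!: sum.cong)
qed (use assms in auto)

lemma mat_adjoint_four_block:
  fixes A B C D :: "complex mat"
  assumes "A \<in> carrier_mat n n" "B \<in> carrier_mat n m" "C \<in> carrier_mat m n" "D \<in> carrier_mat m m"
  shows "mat_adjoint (four_block_mat A B C D)
    = four_block_mat (mat_adjoint A) (mat_adjoint C) (mat_adjoint B) (mat_adjoint D)"
  by (rule eq_matI) (use assms in auto)

definition mat_trace :: "complex mat \<Rightarrow> complex" where
  "mat_trace A = (\<Sum>i<dim_row A. A $$ (i, i))"

lemma mat_trace_mult:
  assumes "A \<in> carrier_mat n m" "B \<in> carrier_mat m n"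
  shows "mat_trace (A * B) = (\<Sum>i<n. \<Sum>j<m. A $$ (i, j) * B $$ (j, i))"
  using assms by (auto simp: mat_trace_def scalar_prod_def atLeast0LessThan intro!: sum.cong)

lemma mat_trace_comm:
  assumes "A \<in> carrier_mat n m" "B \<in> carrier_mat m n"
  shows "mat_trace (A * B) = mat_trace (B * A)"
  unfolding mat_trace_mult[OF assms] mat_trace_mult[OF assms(2,1)]
  by (subst sum.swap) (simp add: mult.commute)

text \<open>Only the left inverse is demanded; for square matrices \<open>unitary_matD\<close>
  recovers the right one.\<close>

definition unitary_mat :: "nat \<Rightarrow> complex mat \<Rightarrow> bool" where
  "unitary_mat n U \<longleftrightarrow> U \<in> carrier_mat n n \<and> mat_adjoint U * U = 1\<^sub>m n"

lemma unitary_matD: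
  assumes "unitary_mat n U"
  shows "U \<in> carrier_mat n n" "mat_adjoint U * U = 1\<^sub>m n" "U * mat_adjoint U = 1\<^sub>m n"
  using assms mat_mult_left_right_inverse[of "mat_adjoint U" n U] by (auto simp: unitary_mat_def)

lemma unitary_mat_adjoint: "unitary_mat n U \<Longrightarrow> unitary_mat n (mat_adjoint U)"
  by (metis mat_adjoint_adjoint mat_adjoint_carrier unitary_mat_def unitary_matD(1,3))

lemma unitary_mat_mult:
  assumes "unitary_mat n U" "unitary_mat n V"
  shows "unitary_mat n (U * V)"
proof -
  note U = unitary_matD[OF assms(1)] and V = unitary_matD[OF assms(2)]
  have "mat_adjoint (U * V) * (U * V) = mat_adjoint V * mat_adjoint U * (U * V)"
    by (simp add: mat_adjoint_mult[OF U(1) V(1)])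
  also have "\<dots> = mat_adjoint V * (mat_adjoint U * (U * V))"
    using U(1) V(1) by (intro assoc_mult_mat[of _ n n _ n _ n]) auto
  also have "mat_adjoint U * (U * V) = mat_adjoint U * U * V"
    using U(1) V(1) by (intro assoc_mult_mat[of _ n n _ n _ n, symmetric]) auto
  finally show ?thesis using U V by (simp add: unitary_mat_def)
qed

lemma unitary_mat_col_norm:
  assumes "unitary_mat n U" "j < n"
  shows "(\<Sum>i<n. (cmod (U $$ (i, j)))\<^sup>2) = 1"
proof -
  note U = unitary_matD[OF assms(1)]
  have "(mat_adjoint U * U) $$ (j, j) = (\<Sum>i<n. complex_of_real ((cmod (U $$ (i, j)))\<^sup>2))"
    using U(1) assms(2)
    by (auto simp: scalar_prod_def atLeast0LessThan complex_norm_square mult.commute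
        simp del: of_real_power intro!: sum.cong)
  then have "complex_of_real (\<Sum>i<n. (cmod (U $$ (i, j)))\<^sup>2) = complex_of_real 1"
    using U(2) assms(2) by simp
  then show ?thesis by (simp only: of_real_eq_iff)
qed

text \<open>Each column has Euclidean norm one, so no entry can exceed one in modulus. Both the
  trace bound and the l1 bound on the energy rest on this estimate.\<close>

lemma unitary_mat_entry_le:
  assumes "unitary_mat n U" "i < n" "j < n"
  shows "cmod (U $$ (i, j)) \<le> 1"
proof -
  have "(cmod (U $$ (i, j)))\<^sup>2 \<le> (\<Sum>i<n. (cmod (U $$ (i, j)))\<^sup>2)"
    by (rule member_le_sum) (use assms in auto)
  then have "(cmod (U $$ (i, j)))\<^sup>2 \<le> 1\<^sup>2"
    using unitary_mat_col_norm[OF assms(1,3)] by simp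
  then show ?thesis by (rule power2_le_imp_le) simp
qed

lemma unitary_mat_diag:
  assumes "\<And>i. i < n \<Longrightarrow> cmod (d i) = 1"
  shows "unitary_mat n (mat_diag n d)"
proof -
  have d: "cnj (d i) * d i = 1" if "i < n" for i
    using assms[OF that] complex_norm_square[of "d i"] by (simp add: mult.commute)
  have a: "mat_adjoint (mat_diag n d) = mat_diag n (\<lambda>i. cnj (d i))"
    by (rule eq_matI) (auto simp: mat_diag_def)
  have "mat_diag n (\<lambda>i. cnj (d i) * d i) = 1\<^sub>m n"
    by (rule eq_matI) (auto simp: mat_diag_def d)
  then show ?thesis
    by (simp add: unitary_mat_def a)
qed

lemma unitary_mat_four_block:
  assumes "unitary_mat m U" "unitary_mat n V"
  shows "unitary_mat (m + n) (four_block_mat U (0\<^sub>m m n) (0\<^sub>m n m) V)"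
proof -
  note U = unitary_matD[OF assms(1)] and V = unitary_matD[OF assms(2)]
  have "mat_adjoint (four_block_mat U (0\<^sub>m m n) (0\<^sub>m n m) V)
      = four_block_mat (mat_adjoint U) (0\<^sub>m m n) (0\<^sub>m n m) (mat_adjoint V)"
    by (subst mat_adjoint_four_block[of _ m _ n]) (use U V in auto)
  moreover have "four_block_mat (mat_adjoint U) (0\<^sub>m m n) (0\<^sub>m n m) (mat_adjoint V)
      * four_block_mat U (0\<^sub>m m n) (0\<^sub>m n m) V = 1\<^sub>m (m + n)"
    by (subst mult_four_block_mat[of _ m m _ n _ n _ _ m _ n]) (use U V in auto)
  ultimately show ?thesis
    using U V by (auto simp: unitary_mat_def)
qed

section \<open>Unitary diagonalization of Hermitian matrices\<close>

text \<open>Complete \<open>v\<close> to a basis, orthogonalize and normalize. Gram-Schmidt leaves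
  the first vector alone, so only a scalar separates the first column from \<open>v\<close>.\<close>

lemma unitary_mat_extend_vec:
  fixes v :: "complex vec"
  assumes v: "v \<in> carrier_vec n" "v \<noteq> 0\<^sub>v n"
  shows "\<exists>W c. unitary_mat n W \<and> col W 0 = c \<cdot>\<^sub>v v"
proof -
  interpret cof_vec_space n "TYPE(complex)" .
  have n: "0 < n" using v by (cases n) auto
  define b where "b = basis_completion v"
  define ws where "ws = gram_schmidt n b"
  note bc = basis_completion[OF v, folded b_def]
  from bc n obtain vs where bv: "b = v # vs" by (cases b) auto
  note gs = gram_schmidt_result[OF bc(2,4,5) ws_def]
  have hd: "ws ! 0 = v"
    using gram_schmidt_hd[OF v(1), of vs] gs(4) bc(6) n by (metis ws_def bv hd_conv_nth list.size(3) less_numeral_extra(3))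
  have len: "length ws = n" using gs(4) bc(6) by simp
  have wsc: "ws ! i \<in> carrier_vec n" if "i < n" for i using gs(3) len that by auto
  \<comment> \<open>The conjugate sits on the first index, as in the entries of
    \<open>mat_adjoint W * W\<close>; the inner product of vectors conjugates its second argument,
    hence the swapped indices in fact \<open>S\<close>.\<close>
  define S where "S i j = (\<Sum>k<n. cnj ((ws ! i) $ k) * (ws ! j) $ k)" for i j
  have S: "S i j = (ws ! j) \<bullet>c (ws ! i)" if "i < n" "j < n" for i j
    using wsc[OF that(1)] wsc[OF that(2)]
    by (auto simp: S_def scalar_prod_def atLeast0LessThan mult.commute intro!: sum.cong)
  have S0: "S i j = 0 \<longleftrightarrow> i \<noteq> j" if "i < n" "j < n" for i j
    using corthogonalD[OF gs(2), of j i] that len S by auto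
  \<comment> \<open>The vectors \<open>ws\<close> are orthogonal but not normalized; these are their
    norms.\<close>
  define r where "r j = sqrt (\<Sum>k<n. (cmod ((ws ! j) $ k))\<^sup>2)" for j
  have rr: "complex_of_real (r j) * complex_of_real (r j) = S j j" for j
  proof -
    have "complex_of_real (r j) * complex_of_real (r j) = complex_of_real (r j * r j)" by simp
    also have "r j * r j = (\<Sum>k<n. (cmod ((ws ! j) $ k))\<^sup>2)"
      unfolding r_def by (simp add: sum_nonneg)
    also have "complex_of_real \<dots> = S j j"
      unfolding S_def of_real_sum complex_norm_square by (simp add: mult.commute)
    finally show ?thesis .
  qed
  define W where "W = mat n n (\<lambda>(i, j). (ws ! j) $ i / complex_of_real (r j))"
  have "mat_adjoint W * W = 1\<^sub>m n"
  proof (rule eq_matI)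
    fix i j assume "i < dim_row (1\<^sub>m n :: complex mat)" "j < dim_col (1\<^sub>m n :: complex mat)"
    then have ij: "i < n" "j < n" by auto
    have "(mat_adjoint W * W) $$ (i, j) = S i j / (complex_of_real (r i) * complex_of_real (r j))"
      using ij by (auto simp: W_def S_def scalar_prod_def atLeast0LessThan sum_divide_distrib intro!: sum.cong)
    \<comment> \<open>Off the diagonal \<open>S\<close> vanishes; on it \<open>S j j\<close> is
      nonzero, so dividing by the squared norm is sound.\<close>
    also have "\<dots> = 1\<^sub>m n $$ (i, j)"
      using S0[OF ij] rr[of j] ij by auto
    finally show "(mat_adjoint W * W) $$ (i, j) = 1\<^sub>m n $$ (i, j)" .
  qed (auto simp: W_def)
  then have "unitary_mat n W" by (simp add: unitary_mat_def W_def)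
  moreover have "col W 0 = (1 / complex_of_real (r 0)) \<cdot>\<^sub>v v"
    by (rule eq_vecI) (use n v in \<open>auto simp: W_def hd\<close>)
  ultimately show ?thesis by blast
qed

lemma hermitian_conjugate:
  fixes A :: "complex mat"
  assumes "A \<in> carrier_mat n n" "W \<in> carrier_mat n n" "mat_adjoint A = A"
  shows "mat_adjoint (mat_adjoint W * A * W) = mat_adjoint W * A * W"
proof -
  have "mat_adjoint (mat_adjoint W * A * W) = mat_adjoint W * mat_adjoint (mat_adjoint W * A)"
    by (rule mat_adjoint_mult) (use assms in auto)
  also have "mat_adjoint (mat_adjoint W * A) = A * W"
    using mat_adjoint_mult[of "mat_adjoint W" n n A n] assms by simp
  finally show ?thesis
    using assoc_mult_mat[of "mat_adjoint W" n n A n W n] assms by simp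
qed

lemma unitary_conjugate_cancel:
  assumes W: "unitary_mat n W" and A: "A \<in> carrier_mat n n"
  shows "W * (mat_adjoint W * A * W) * mat_adjoint W = A"
proof -
  note U = unitary_matD[OF W]
  have c: "mat_adjoint W \<in> carrier_mat n n" using U by simp
  have "W * (mat_adjoint W * A * W) * mat_adjoint W = (W * mat_adjoint W) * A * (W * mat_adjoint W)"
    using A U(1) c by (simp add: assoc_mult_mat[of _ n n _ n _ n] mult_carrier_mat[of _ n n _ n])
  then show ?thesis using U A by simp
qed


lemma char_poly_unitary_conjugate:
  assumes W: "unitary_mat n W" and A: "A \<in> carrier_mat n n"
  shows "char_poly (mat_adjoint W * A * W) = char_poly A"
proof (rule char_poly_similar)
  note U = unitary_matD[OF W]
  show "similar_mat (mat_adjoint W * A * W) A"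
    by (rule similar_matI[of _ _ "mat_adjoint W" W n]) (use U A in auto)
qed

text \<open>Deflation: a unitary change of basis whose first vector is an eigenvector splits off a
  \<open>1 \<times> 1\<close> block, and the remaining block is again Hermitian.\<close>

lemma hermitian_unitary_diag:
  fixes A :: "complex mat"
  assumes "A \<in> carrier_mat n n" "mat_adjoint A = A" "char_poly A = (\<Prod>e\<leftarrow>es. [:- e, 1:])"
  shows "\<exists>V. unitary_mat n V \<and> A = V * mat_diag n ((!) es) * mat_adjoint V"
  using assms
proof (induction es arbitrary: n A)
  case Nil
  \<comment> \<open>The degree of the characteristic polynomial is the dimension, so an empty list
    of roots means an empty matrix.\<close>
  then have n: "n = 0" using degree_monic_char_poly[of A n] by simp
  have "unitary_mat n (1\<^sub>m n)"
    by (simp add: unitary_mat_def)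
  moreover have "A = 1\<^sub>m n * mat_diag n ((!) []) * mat_adjoint (1\<^sub>m n)"
    by (rule eq_matI) (use Nil n in auto)
  ultimately show ?case by blast
next
  case (Cons e es)
  note A = Cons.prems(1)
  have ev: "eigenvalue A e"
    using Cons.prems(3) by (simp add: eigenvalue_root_char_poly[OF A])
  then obtain v where v: "v \<in> carrier_vec n" "v \<noteq> 0\<^sub>v n" "A *\<^sub>v v = e \<cdot>\<^sub>v v"
    using A by (auto simp: eigenvalue_def eigenvector_def)
  then obtain m where n: "n = Suc m" by (cases n) auto
  from unitary_mat_extend_vec[OF v(1,2)] obtain W c
    where W: "unitary_mat n W" and colW: "col W 0 = c \<cdot>\<^sub>v v" by blast
  note U = unitary_matD[OF W]
  have Wa: "mat_adjoint W \<in> carrier_mat n n" using U by simp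
  have cW: "col W 0 \<in> carrier_vec n" using U(1) by auto
  define B where "B = mat_adjoint W * A * W"
  have B: "B \<in> carrier_mat n n" using A U(1) Wa by (auto simp: B_def)
  have B_herm: "mat_adjoint B = B"
    unfolding B_def by (rule hermitian_conjugate[OF A U(1) Cons.prems(2)])
  have "A *\<^sub>v col W 0 = e \<cdot>\<^sub>v col W 0"
    unfolding colW mult_mat_vec[OF A v(1)] v(3) by (simp add: smult_smult_assoc mult.commute)
  then have "mat_adjoint W *\<^sub>v (A *\<^sub>v col W 0) = e \<cdot>\<^sub>v (mat_adjoint W *\<^sub>v col W 0)"
    using mult_mat_vec[OF Wa cW] by simp
  moreover have "mat_adjoint W *\<^sub>v col W 0 = unit_vec n 0"
    using col_mult2[OF Wa U(1), of 0] U(2) n by simp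
  moreover have "col B 0 = mat_adjoint W *\<^sub>v (A *\<^sub>v col W 0)"
    unfolding B_def
    by (subst col_mult2[of _ n n _ n]) (use A Wa U(1) n assoc_mult_mat_vec[OF Wa A cW] in auto)
  ultimately have colB: "col B 0 = e \<cdot>\<^sub>v unit_vec n 0" by simp
  have B0: "B $$ (i, 0) = (if i = 0 then e else 0)" if "i < n" for i
    using arg_cong[OF colB, of "\<lambda>w. w $ i"] that B n by (auto simp: col_def)
  \<comment> \<open>Hermitian symmetry carries the zeros of the first column over to the first
    row.\<close>
  have B0': "B $$ (0, i) = 0" if "i < n" "i \<noteq> 0" for i
    using arg_cong[OF B_herm, of "\<lambda>M. M $$ (0, i)"] that B B0[of i] by auto
  define C where "C = mat m m (\<lambda>(i, j). B $$ (Suc i, Suc j))"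
  have C: "C \<in> carrier_mat m m" by (simp add: C_def)
  define E where "E = mat 1 1 (\<lambda>_. e)"
  have E: "E \<in> carrier_mat 1 1" by (simp add: E_def)
  have BC: "B = four_block_mat E (0\<^sub>m 1 m) (0\<^sub>m m 1) C"
    by (rule eq_matI) (use B n B0 B0' in \<open>auto simp: E_def C_def\<close>)
  have "mat_adjoint C = C"
  proof (rule eq_matI)
    fix i j assume "i < dim_row C" "j < dim_col C"
    then show "mat_adjoint C $$ (i, j) = C $$ (i, j)"
      using arg_cong[OF B_herm, of "\<lambda>M. M $$ (Suc i, Suc j)"] B n by (auto simp: C_def)
  qed (auto simp: C_def)
  moreover have "char_poly C = (\<Prod>e\<leftarrow>es. [:- e, 1:])"
  proof -
    have "[:- e, 1:] * (\<Prod>e\<leftarrow>es. [:- e, 1:]) = char_poly B"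
      using Cons.prems(3) char_poly_unitary_conjugate[OF W A] by (simp add: B_def)
    also have "\<dots> = char_poly E * char_poly C"
      unfolding BC by (rule char_poly_four_block_zeros_col[OF E _ C]) simp
    also have "char_poly E = [:- e, 1:]"
      by (simp add: E_def char_poly_defs det_def sign_def)
    \<comment> \<open>Complex polynomials form an integral domain, so the linear factor of
      \<open>e\<close> cancels.\<close>
    finally show ?thesis
      by (metis mult_cancel_left pCons_eq_0_iff zero_neq_one)
  qed
  ultimately obtain X where X: "unitary_mat m X"
    and CX: "C = X * mat_diag m ((!) es) * mat_adjoint X"
    using Cons.IH[OF C] by blast
  note UX = unitary_matD[OF X]
  have Xa: "mat_adjoint X \<in> carrier_mat m m" using UX by simp
  let ?D = "mat_diag n ((!) (e # es))"
  have D: "?D = four_block_mat E (0\<^sub>m 1 m) (0\<^sub>m m 1) (mat_diag m ((!) es))"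
    by (rule eq_matI) (use n in \<open>auto simp: mat_diag_def E_def nth_Cons'\<close>)
  have "unitary_mat 1 (1\<^sub>m 1)" by (simp add: unitary_mat_def)
  note one = unitary_mat_four_block[OF this X]
  \<comment> \<open>\<open>Y\<close> keeps the first basis vector and diagonalizes the remaining
    block; \<open>W * Y\<close> then diagonalizes \<open>A\<close>.\<close>
  define Y where "Y = four_block_mat (1\<^sub>m 1) (0\<^sub>m 1 m) (0\<^sub>m m 1) X"
  have Y: "unitary_mat n Y"
    using one by (simp add: Y_def n)
  have Ya: "mat_adjoint Y = four_block_mat (1\<^sub>m 1) (0\<^sub>m 1 m) (0\<^sub>m m 1) (mat_adjoint X)"
    unfolding Y_def by (subst mat_adjoint_four_block[of _ 1 _ m]) (use UX in auto)
  have XD: "X * mat_diag m ((!) es) \<in> carrier_mat m m" using UX(1) by auto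
  have zD: "0\<^sub>m 1 m * mat_diag m ((!) es) = 0\<^sub>m 1 m"
    by (rule left_mult_zero_mat[OF mat_diag_dim])
  have "Y * ?D = four_block_mat E (0\<^sub>m 1 m) (0\<^sub>m m 1) (X * mat_diag m ((!) es))"
    unfolding Y_def D
    by (subst mult_four_block_mat[of _ 1 1 _ m _ m _ _ 1 _ m]) (use UX(1) E XD zD in auto)
  moreover have "four_block_mat E (0\<^sub>m 1 m) (0\<^sub>m m 1) (X * mat_diag m ((!) es)) * mat_adjoint Y = B"
    unfolding Ya BC CX
    by (subst mult_four_block_mat[of _ 1 1 _ m _ m _ _ 1 _ m]) (use Xa E XD left_mult_zero_mat[OF Xa] right_mult_zero_mat[OF XD] in auto)
  ultimately have BY: "B = Y * ?D * mat_adjoint Y" by simp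
  note UY = unitary_matD[OF Y]
  have YDc: "Y * ?D \<in> carrier_mat n n" using UY(1) by auto
  have Yac: "mat_adjoint Y \<in> carrier_mat n n" using UY(1) by simp
  have "A = W * B * mat_adjoint W"
    unfolding B_def by (rule unitary_conjugate_cancel[OF W A, symmetric])
  also have "\<dots> = (W * Y) * ?D * mat_adjoint (W * Y)"
    unfolding BY mat_adjoint_mult[OF U(1) UY(1)]
    using U(1) UY(1) Wa Yac
    by (simp add: assoc_mult_mat[of _ n n _ n _ n] mult_carrier_mat[of _ n n _ n])
  finally show ?case using unitary_mat_mult[OF W Y] by blast
qed

section \<open>Energy as a trace norm\<close>

text \<open>The energy weights distinct eigenvalues by their order, whereas a list of roots repeats
  them. Orders add over products, so each linear factor contributes its modulus exactly
  once.\<close>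

lemma matrix_energy_factorized:
  assumes A: "A \<in> carrier_mat n n" and es: "char_poly A = (\<Prod>e\<leftarrow>es. [:- e, 1:])"
  shows "matrix_energy A = (\<Sum>e\<leftarrow>es. cmod e)"
proof -
  have "spectrum A = set es"
    by (auto simp: spectrum_def eigenvalue_root_char_poly[OF A] es poly_prod_list prod_list_zero_iff)
  \<comment> \<open>The index set is an arbitrary finite superset of the roots, because the root set
    itself changes during the induction on \<open>es\<close>; points that are not roots have order
    zero.\<close>
  moreover have "(\<Sum>\<mu>\<in>S. real (order \<mu> (\<Prod>e\<leftarrow>es. [:- e, 1:])) * cmod \<mu>) = (\<Sum>e\<leftarrow>es. cmod e)"
    if "finite S" "set es \<subseteq> S" for S
    using that(2)
  proof (induction es)
    case (Cons a es)
    let ?p = "\<Prod>e\<leftarrow>es. [:- e, 1:]"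
    have "?p \<noteq> 0" by (auto simp: prod_list_zero_iff)
    then have "order \<mu> ([:- a, 1:] * ?p) = order \<mu> [:- a, 1:] + order \<mu> ?p" for \<mu>
      by (intro order_mult no_zero_divisors) auto
    then have "order \<mu> (\<Prod>e\<leftarrow>a # es. [:- e, 1:]) = (if \<mu> = a then 1 else 0) + order \<mu> ?p" for \<mu>
      by (simp only: list.map prod_list.Cons order_linear' neg_equal_iff_equal eq_commute[of a])
    then have "(\<Sum>\<mu>\<in>S. real (order \<mu> (\<Prod>e\<leftarrow>a # es. [:- e, 1:])) * cmod \<mu>)
        = (\<Sum>\<mu>\<in>S. (if \<mu> = a then cmod \<mu> else 0)) + (\<Sum>\<mu>\<in>S. real (order \<mu> (\<Prod>e\<leftarrow>es. [:- e, 1:])) * cmod \<mu>)"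
      unfolding sum.distrib[symmetric] by (intro sum.cong) (auto simp: algebra_simps)
    with Cons that(1) show ?case by simp
  qed simp
  ultimately show ?thesis by (simp add: matrix_energy_def es)
qed

lemma matrix_energy_nonneg: "0 \<le> matrix_energy A"
  by (simp add: matrix_energy_def sum_nonneg)

text \<open>One list of roots feeds both the diagonalization and the energy formula, which ties the
  diagonal entries to the energy.\<close>

lemma hermitian_energy_diag:
  assumes A: "A \<in> carrier_mat n n" and herm: "mat_adjoint A = A"
  obtains V d where "unitary_mat n V" "A = V * mat_diag n d * mat_adjoint V"
    "matrix_energy A = (\<Sum>i<n. cmod (d i))"
proof -
  from char_poly_factorized[OF A] obtain es
    where es: "char_poly A = (\<Prod>e\<leftarrow>es. [:- e, 1:])" "length es = n" by blast
  from hermitian_unitary_diag[OF A herm es(1)] obtain V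
    where V: "unitary_mat n V" "A = V * mat_diag n ((!) es) * mat_adjoint V" by blast
  have "matrix_energy A = (\<Sum>i<n. cmod (es ! i))"
    using matrix_energy_factorized[OF A es(1)] es(2) by (simp add: sum_list_sum_nth atLeast0LessThan)
  with V that show thesis by blast
qed

text \<open>Cyclicity of the trace brings \<open>mat_adjoint V\<close> to the front, and a diagonal
  factor sees only the diagonal of what it multiplies.\<close>

lemma mat_trace_unitary_diag:
  assumes "unitary_mat n V" and U: "U \<in> carrier_mat n n"
  shows "mat_trace (U * (V * mat_diag n d * mat_adjoint V))
    = (\<Sum>i<n. (mat_adjoint V * U * V) $$ (i, i) * d i)"
proof -
  have V: "V \<in> carrier_mat n n" using assms(1) by (simp add: unitary_mat_def)
  have Va: "mat_adjoint V \<in> carrier_mat n n" using V by simp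
  have W: "mat_adjoint V * U * V \<in> carrier_mat n n" using U V Va by auto
  have UVD: "U * V * mat_diag n d \<in> carrier_mat n n"
    by (intro mult_carrier_mat[of _ n n _ n] U V mat_diag_dim)
  have "U * (V * mat_diag n d * mat_adjoint V) = (U * V * mat_diag n d) * mat_adjoint V"
    using U V Va by (simp add: assoc_mult_mat[of _ n n _ n _ n] mult_carrier_mat[of _ n n _ n])
  also have "mat_trace \<dots> = mat_trace (mat_adjoint V * (U * V * mat_diag n d))"
    by (rule mat_trace_comm[OF UVD Va])
  also have "mat_adjoint V * (U * V * mat_diag n d) = (mat_adjoint V * U * V) * mat_diag n d"
    using U V Va by (simp add: assoc_mult_mat[of _ n n _ n _ n] mult_carrier_mat[of _ n n _ n])
  also have "mat_trace \<dots> = (\<Sum>i<n. (mat_adjoint V * U * V) $$ (i, i) * d i)"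
    unfolding mat_diag_mult_right[OF W] by (simp add: mat_trace_def)
  finally show ?thesis .
qed

text \<open>Upper half of the trace norm duality: in the eigenbasis of \<open>A\<close> the matrix
  \<open>U\<close> stays unitary, so each eigenvalue is weighted by a number of modulus at most
  one.\<close>

lemma hermitian_trace_le_energy:
  assumes A: "A \<in> carrier_mat n n" "mat_adjoint A = A" and U: "unitary_mat n U"
  shows "cmod (mat_trace (U * A)) \<le> matrix_energy A"
proof -
  from hermitian_energy_diag[OF A] obtain V d where V: "unitary_mat n V"
    and Ad: "A = V * mat_diag n d * mat_adjoint V" and e: "matrix_energy A = (\<Sum>i<n. cmod (d i))" .
  let ?W = "mat_adjoint V * U * V"
  have W: "unitary_mat n ?W"
    by (intro unitary_mat_mult unitary_mat_adjoint U V)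
  have UC: "U \<in> carrier_mat n n" using U by (simp add: unitary_mat_def)
  have "cmod (mat_trace (U * A)) = cmod (\<Sum>i<n. ?W $$ (i, i) * d i)"
    unfolding Ad mat_trace_unitary_diag[OF V UC] ..
  also have "\<dots> \<le> (\<Sum>i<n. cmod (?W $$ (i, i) * d i))" by (rule norm_sum)
  also have "\<dots> \<le> (\<Sum>i<n. cmod (d i))"
    using unitary_mat_entry_le[OF W] by (intro sum_mono) (simp add: norm_mult mult_left_le_one_le)
  finally show ?thesis by (simp add: e)
qed

text \<open>Lower half of the duality: the optimal \<open>U\<close> is diagonal in the eigenbasis of
  \<open>A\<close> and cancels the phases of the eigenvalues.\<close>

lemma hermitian_energy_attained:
  assumes A: "A \<in> carrier_mat n n" "mat_adjoint A = A"
  obtains U where "unitary_mat n U" "mat_trace (U * A) = complex_of_real (matrix_energy A)"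
proof -
  from hermitian_energy_diag[OF A] obtain V d where V: "unitary_mat n V"
    and Ad: "A = V * mat_diag n d * mat_adjoint V" and e: "matrix_energy A = (\<Sum>i<n. cmod (d i))" .
  \<comment> \<open>The conjugate sign turns \<open>d i\<close> into its modulus. Since
    \<open>sgn 0 = 0\<close> does not have modulus one, a zero entry gets the phase \<open>1\<close>
    instead.\<close>
  define s where "s i = (if d i = 0 then 1 else cnj (sgn (d i)))" for i
  have s: "cmod (s i) = 1" "s i * d i = complex_of_real (cmod (d i))" for i
  proof -
    show "cmod (s i) = 1" by (simp add: s_def norm_sgn)
    have "cnj (sgn (d i)) * d i = (d i * cnj (d i)) / complex_of_real (cmod (d i))"
      by (simp add: sgn_eq mult.commute)
    also have "\<dots> = complex_of_real (cmod (d i))"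
      by (simp add: complex_norm_square[symmetric] power2_eq_square)
    finally show "s i * d i = complex_of_real (cmod (d i))" by (simp add: s_def)
  qed
  define U where "U = V * mat_diag n s * mat_adjoint V"
  have U: "unitary_mat n U"
    unfolding U_def by (intro unitary_mat_mult unitary_mat_adjoint V unitary_mat_diag s)
  have UC: "U \<in> carrier_mat n n" using U by (simp add: unitary_mat_def)
  \<comment> \<open>With \<open>mat_adjoint V\<close> as the unitary matrix, the cancellation lemma
    undoes the conjugation that defines \<open>U\<close>.\<close>
  have "mat_adjoint V * U * V = mat_diag n s"
    using unitary_conjugate_cancel[OF unitary_mat_adjoint[OF V], of "mat_diag n s"] by (simp add: U_def)
  then have "mat_trace (U * A) = (\<Sum>i<n. mat_diag n s $$ (i, i) * d i)"
    unfolding Ad mat_trace_unitary_diag[OF V UC] by simp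
  also have "\<dots> = complex_of_real (matrix_energy A)"
    by (simp add: mat_diag_def s e)
  finally show thesis using U that by blast
qed

text \<open>Test both matrices with the \<open>U\<close> that is optimal for \<open>A\<close>: it
  yields the energy of \<open>A\<close> on one side and at most that of \<open>B\<close> on the
  other.\<close>

lemma matrix_energy_perturb:
  assumes A: "A \<in> carrier_mat n n" "mat_adjoint A = A" and B: "B \<in> carrier_mat n n" "mat_adjoint B = B"
    and close: "\<And>U. unitary_mat n U \<Longrightarrow> cmod (mat_trace (U * A) - mat_trace (U * B)) \<le> c"
  shows "matrix_energy A \<le> matrix_energy B + c"
proof -
  from hermitian_energy_attained[OF A] obtain U
    where U: "unitary_mat n U" "mat_trace (U * A) = complex_of_real (matrix_energy A)" .
  have "matrix_energy A = cmod (mat_trace (U * A))"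
    by (simp add: U matrix_energy_nonneg)
  also have "\<dots> \<le> cmod (mat_trace (U * B)) + cmod (mat_trace (U * A) - mat_trace (U * B))"
    by (metis add.commute diff_add_cancel norm_triangle_ineq)
  also have "\<dots> \<le> matrix_energy B + c"
    by (intro add_mono hermitian_trace_le_energy[OF B] close U)
  finally show ?thesis .
qed

section \<open>Entrywise norms under two-sided multiplication by a unitary matrix\<close>

text \<open>\<open>F * A * F\<close> need not be similar to \<open>A\<close>, so eigenvalues cannot
  be compared directly. In the trace with the optimal \<open>U\<close>, however, both factors can be
  absorbed into a unitary \<open>W\<close>, whose entries have modulus at most one.\<close>

lemma energy_le_entry_l1_norm:
  assumes A: "A \<in> carrier_mat n n" "mat_adjoint A = A" and F: "unitary_mat n F"
  shows "matrix_energy A \<le> entry_l1_norm (F * A * F)"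
proof -
  note UF = unitary_matD[OF F]
  from hermitian_energy_attained[OF A] obtain U
    where U: "unitary_mat n U" "mat_trace (U * A) = complex_of_real (matrix_energy A)" .
  have UC: "U \<in> carrier_mat n n" using U by (simp add: unitary_mat_def)
  define G where "G = mat_adjoint F"
  have G: "G \<in> carrier_mat n n" "G * F = 1\<^sub>m n" "F * G = 1\<^sub>m n" using UF by (simp_all add: G_def)
  define M where "M = F * A * F"
  have M: "M \<in> carrier_mat n n" using UF(1) A by (auto simp: M_def)
  define W where "W = G * U * G"
  have W: "unitary_mat n W"
    unfolding W_def G_def by (intro unitary_mat_mult unitary_mat_adjoint U F)
  have WC: "W \<in> carrier_mat n n" using W by (simp add: unitary_mat_def)
  have UGM: "U * G * M \<in> carrier_mat n n" using UC G M by auto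
  have "G * M * G = (G * F) * A * (F * G)"
    using G(1) UF(1) A(1) by (simp add: M_def assoc_mult_mat[of _ n n _ n _ n] mult_carrier_mat[of _ n n _ n])
  then have "A = G * M * G" using G A by simp
  then have "U * A = (U * G * M) * G"
    using UC G(1) M by (simp add: assoc_mult_mat[of _ n n _ n _ n] mult_carrier_mat[of _ n n _ n])
  then have "mat_trace (U * A) = mat_trace (G * (U * G * M))"
    using mat_trace_comm[OF UGM G(1)] by simp
  also have "G * (U * G * M) = W * M"
    using UC G(1) M by (simp add: W_def assoc_mult_mat[of _ n n _ n _ n] mult_carrier_mat[of _ n n _ n])
  also have "mat_trace (W * M) = (\<Sum>i<n. \<Sum>j<n. W $$ (i, j) * M $$ (j, i))"
    by (rule mat_trace_mult[OF WC M])
  finally have "matrix_energy A = cmod (\<Sum>i<n. \<Sum>j<n. W $$ (i, j) * M $$ (j, i))"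
    using U(2) matrix_energy_nonneg[of A] by (metis norm_of_real abs_of_nonneg)
  also have "\<dots> \<le> (\<Sum>i<n. \<Sum>j<n. cmod (W $$ (i, j) * M $$ (j, i)))"
    by (intro order_trans[OF norm_sum] sum_mono norm_sum)
  also have "\<dots> \<le> (\<Sum>i<n. \<Sum>j<n. cmod (M $$ (j, i)))"
    using unitary_mat_entry_le[OF W] by (intro sum_mono) (simp add: norm_mult mult_left_le_one_le)
  also have "\<dots> = entry_l1_norm M"
    using M by (subst sum.swap) (simp add: entry_l1_norm_def)
  finally show ?thesis by (simp add: M_def)
qed

text \<open>The trace form reduces unitary invariance to cyclicity of the trace.\<close>

lemma frobenius_norm_trace:
  assumes "M \<in> carrier_mat n n"
  shows "frobenius_norm M = sqrt (Re (mat_trace (mat_adjoint M * M)))"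
proof -
  have "mat_trace (mat_adjoint M * M) = (\<Sum>i<n. \<Sum>j<n. complex_of_real ((cmod (M $$ (j, i)))\<^sup>2))"
    unfolding complex_norm_square using assms
    by (subst mat_trace_mult[of _ n n]) (auto simp: mult.commute)
  also have "Re \<dots> = (\<Sum>i<n. \<Sum>j<n. (cmod (M $$ (j, i)))\<^sup>2)"
    unfolding of_real_sum[symmetric] by simp
  also have "\<dots> = (\<Sum>j<n. \<Sum>i<n. (cmod (M $$ (j, i)))\<^sup>2)" by (rule sum.swap)
  finally show ?thesis using assms by (simp add: frobenius_norm_def)
qed

text \<open>With \<open>M = F * A * F\<close>, the left copy of \<open>F\<close> cancels inside
  \<open>mat_adjoint M * M\<close>; the right copy cancels once the trace is rotated.\<close>

lemma frobenius_norm_unitary: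
  assumes A: "A \<in> carrier_mat n n" and F: "unitary_mat n F"
  shows "frobenius_norm (F * A * F) = frobenius_norm A"
proof -
  note UF = unitary_matD[OF F]
  have Fa: "mat_adjoint F \<in> carrier_mat n n" and Aa: "mat_adjoint A \<in> carrier_mat n n"
    using UF A by simp_all
  have AF: "A * F \<in> carrier_mat n n" using A UF by auto
  have FAF: "F * A * F \<in> carrier_mat n n" using A UF by auto
  have c: "mat_adjoint A * A * F \<in> carrier_mat n n" using A Aa UF by auto
  have "mat_adjoint (F * A * F) = mat_adjoint F * mat_adjoint A * mat_adjoint F"
    using mat_adjoint_mult[OF UF(1) AF] mat_adjoint_mult[OF A UF(1)] assoc_mult_mat[OF UF(1) A UF(1)]
    by simp
  then have "mat_adjoint (F * A * F) * (F * A * F)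
      = mat_adjoint F * mat_adjoint A * (mat_adjoint F * F) * A * F"
    using Fa Aa A UF(1)
    by (simp add: assoc_mult_mat[of _ n n _ n _ n] mult_carrier_mat[of _ n n _ n])
  also have "\<dots> = mat_adjoint F * (mat_adjoint A * A * F)"
    unfolding UF(2) using Fa Aa A UF(1)
    by (simp add: assoc_mult_mat[of _ n n _ n _ n] mult_carrier_mat[of _ n n _ n])
  finally have "mat_trace (mat_adjoint (F * A * F) * (F * A * F))
      = mat_trace (mat_adjoint A * A * F * mat_adjoint F)"
    using mat_trace_comm[OF Fa c] by simp
  also have "mat_adjoint A * A * F * mat_adjoint F = mat_adjoint A * A * (F * mat_adjoint F)"
    using Fa Aa A UF(1)
    by (simp add: assoc_mult_mat[of _ n n _ n _ n] mult_carrier_mat[of _ n n _ n])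
  also have "\<dots> = mat_adjoint A * A" unfolding UF(3) using Aa A by auto
  finally show ?thesis
    by (simp add: frobenius_norm_trace[OF FAF] frobenius_norm_trace[OF A])
qed

section \<open>Block sums of a unitary matrix\<close>

text \<open>The block sum is the inner product of the indicator of \<open>I\<close> with the image
  of the indicator of \<open>J\<close> under \<open>U\<close>. As \<open>U\<close> preserves norms,
  Cauchy-Schwarz gives the bound.\<close>

lemma unitary_mat_block_sum_le:
  assumes U: "unitary_mat n U" and I: "I \<subseteq> {..<n}" and J: "J \<subseteq> {..<n}"
  shows "cmod (\<Sum>i\<in>I. \<Sum>j\<in>J. U $$ (i, j)) \<le> sqrt (real (card I) * real (card J))"
proof -
  note UU = unitary_matD[OF U]
  have fin: "finite I" "finite J" using I J finite_subset by blast+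
  \<comment> \<open>The image under \<open>U\<close> of the indicator vector of
    \<open>J\<close>.\<close>
  define y where "y i = (\<Sum>j\<in>J. U $$ (i, j))" for i
  have entry: "(\<Sum>i<n. cnj (U $$ (i, j)) * U $$ (i, k)) = (if j = k then 1 else 0)"
    if "j \<in> J" "k \<in> J" for j k
    using arg_cong[OF UU(2), of "\<lambda>M. M $$ (j, k)"] that J UU(1)
    by (auto simp: scalar_prod_def atLeast0LessThan subset_iff)
  \<comment> \<open>Expanding the squared norm of \<open>y\<close> and summing over rows first
    leaves only inner products of columns, which are orthonormal by \<open>entry\<close>.\<close>
  have "complex_of_real (\<Sum>i<n. (cmod (y i))\<^sup>2) = (\<Sum>i<n. \<Sum>j\<in>J. \<Sum>k\<in>J. cnj (U $$ (i, j)) * U $$ (i, k))"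
  proof -
    have "complex_of_real ((cmod (y i))\<^sup>2) = (\<Sum>j\<in>J. \<Sum>k\<in>J. cnj (U $$ (i, j)) * U $$ (i, k))" for i
    proof -
      have "complex_of_real ((cmod (y i))\<^sup>2) = cnj (y i) * y i"
        unfolding complex_norm_square by (rule mult.commute)
      also have "\<dots> = (\<Sum>j\<in>J. \<Sum>k\<in>J. cnj (U $$ (i, j)) * U $$ (i, k))"
        by (simp add: y_def sum_product)
      finally show ?thesis .
    qed
    then show ?thesis by (simp only: of_real_sum)
  qed
  also have "\<dots> = (\<Sum>j\<in>J. \<Sum>i<n. \<Sum>k\<in>J. cnj (U $$ (i, j)) * U $$ (i, k))"
    by (rule sum.swap)
  also have "\<dots> = (\<Sum>j\<in>J. \<Sum>k\<in>J. \<Sum>i<n. cnj (U $$ (i, j)) * U $$ (i, k))"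
    by (intro sum.cong refl sum.swap)
  also have "\<dots> = (\<Sum>j\<in>J. \<Sum>k\<in>J. if j = k then 1 else 0)"
    by (intro sum.cong refl entry)
  also have "\<dots> = complex_of_real (real (card J))" using fin by simp
  finally have y: "(\<Sum>i<n. (cmod (y i))\<^sup>2) = real (card J)" by (simp only: of_real_eq_iff)
  have "(cmod (\<Sum>i\<in>I. y i))\<^sup>2 \<le> (\<Sum>i\<in>I. cmod (y i))\<^sup>2"
    by (intro power_mono norm_sum) simp
  \<comment> \<open>Cauchy-Schwarz against the all-ones vector on \<open>I\<close>.\<close>
  also have "\<dots> \<le> (\<Sum>i\<in>I. (cmod (y i))\<^sup>2) * real (card I)"
    by (rule sum_squared_le_sum_of_squares)
  also have "\<dots> \<le> (\<Sum>i<n. (cmod (y i))\<^sup>2) * real (card I)"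
    using I by (intro mult_right_mono sum_mono2) auto
  also have "\<dots> = real (card I) * real (card J)" by (simp add: y)
  finally show ?thesis unfolding y_def by (rule real_le_rsqrt)
qed

section \<open>The Fourier matrix\<close>

text \<open>The inner product of two columns is a geometric sum in an \<open>N\<close>-th root of
  unity, which vanishes unless that root is 1.\<close>

lemma unitary_fourier_matrix:
  assumes N: "0 < N"
  shows "unitary_mat N (fourier_matrix N)"
proof -
  define w where "w k = cis (2 * pi * real k / real N)" for k
  have w_root: "w k ^ N = 1" for k
    using N by (simp add: w_def Complex.DeMoivre cis_multiple_2pi)
  \<comment> \<open>Distinct exponents below \<open>N\<close> give distinct roots, which makes the
    ratio \<open>q\<close> below differ from 1 off the diagonal.\<close>
  have w_inj: "w j = w k \<longleftrightarrow> j = k" if "j < N" "k < N" for j k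
    using bij_betw_roots_unity[OF N] that unfolding w_def bij_betw_def inj_on_def by auto
  have w0: "w k \<noteq> 0" for k by (simp add: w_def)
  have F: "fourier_matrix N $$ (x, k) = inverse (w k) ^ x / complex_of_real (sqrt (real N))"
    if "x < N" "k < N" for x k
  proof -
    have "exp (- (2 * complex_of_real pi * \<i> * of_nat x * of_nat k / of_nat N)) = inverse (w k) ^ x"
      by (simp add: w_def cis_conv_exp exp_minus[symmetric] exp_of_nat_mult[symmetric] mult_ac)
    then show ?thesis using that by (simp add: fourier_matrix_def)
  qed
  \<comment> \<open>On the unit circle conjugation is inversion; hence a product of column entries
    becomes a power of a single ratio.\<close>
  have cnj_w: "cnj (inverse (w k)) = w k" for k
    by (simp add: w_def cis_cnj)
  have "mat_adjoint (fourier_matrix N) * fourier_matrix N = 1\<^sub>m N"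
  proof (rule eq_matI)
    fix j k assume "j < dim_row (1\<^sub>m N :: complex mat)" "k < dim_col (1\<^sub>m N :: complex mat)"
    then have jk: "j < N" "k < N" by auto
    define q where "q = w j / w k"
    have "(mat_adjoint (fourier_matrix N) * fourier_matrix N) $$ (j, k)
        = (\<Sum>x<N. cnj (fourier_matrix N $$ (x, j)) * fourier_matrix N $$ (x, k))"
      using jk by (simp add: fourier_matrix_def scalar_prod_def atLeast0LessThan)
    also have "\<dots> = (\<Sum>x<N. q ^ x / of_nat N)"
    proof (rule sum.cong[OF refl])
      fix x assume "x \<in> {..<N}"
      then have x: "x < N" by simp
      define c where "c = complex_of_real (sqrt (real N))"
      have c: "c * c = of_nat N" "cnj c = c" by (simp_all add: c_def flip: of_real_mult)
      have "cnj (fourier_matrix N $$ (x, j)) = w j ^ x / c"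
        unfolding F[OF x jk(1)] c_def[symmetric] by (simp only: complex_cnj_divide complex_cnj_power cnj_w c)
      then have "cnj (fourier_matrix N $$ (x, j)) * fourier_matrix N $$ (x, k)
          = (w j * inverse (w k)) ^ x / (c * c)"
        unfolding F[OF x jk(2)] c_def[symmetric] by (simp only: times_divide_times_eq power_mult_distrib)
      then show "cnj (fourier_matrix N $$ (x, j)) * fourier_matrix N $$ (x, k) = q ^ x / of_nat N"
        by (simp only: c q_def divide_inverse)
    qed
    also have "\<dots> = (\<Sum>x<N. q ^ x) / of_nat N" by (simp add: sum_divide_distrib)
    also have "\<dots> = 1\<^sub>m N $$ (j, k)"
    proof (cases "j = k")
      case True
      then have "q = 1" by (simp add: q_def w0)
      then show ?thesis using N jk True by simp
    next
      case False
      then have "q \<noteq> 1" using w_inj[OF jk] by (simp add: q_def w0)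
      moreover have "q ^ N = 1" by (simp add: q_def power_divide w_root)
      ultimately have "(\<Sum>x<N. q ^ x) = 0" by (simp add: geometric_sum)
      then show ?thesis using False jk by simp
    qed
    finally show "(mat_adjoint (fourier_matrix N) * fourier_matrix N) $$ (j, k) = 1\<^sub>m N $$ (j, k)" .
  qed (auto simp: fourier_matrix_def)
  then show ?thesis by (simp add: unitary_mat_def fourier_matrix_def)
qed

section \<open>Adjacency matrices\<close>

lemma pair_graph_arc_sym:
  assumes "pair_graph G" "(u, v) \<in> parcs G"
  shows "(v, u) \<in> parcs G"
proof -
  interpret pair_graph G by fact
  show ?thesis using pair_sym_arcs assms(2) unfolding symmetric_def sym_def by simp
qed

lemma parcs_subset:
  assumes "pair_graph G"
  shows "parcs G \<subseteq> pverts G \<times> pverts G"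
proof
  interpret pair_graph G by fact
  fix e assume "e \<in> parcs G"
  then show "e \<in> pverts G \<times> pverts G"
    using arc_fst_in_verts[of e] arc_snd_in_verts[of e] by (simp add: mem_Times_iff)
qed

lemma adj_matrix_carrier [simp]: "adj_matrix G \<sigma> \<in> carrier_mat (order_of G) (order_of G)"
  by (simp add: adj_matrix_def)

lemma adj_matrix_hermitian:
  assumes "pair_graph G"
  shows "mat_adjoint (adj_matrix G \<sigma>) = adj_matrix G \<sigma>"
  by (rule eq_matI) (auto simp: adj_matrix_def dest: pair_graph_arc_sym[OF assms])

text \<open>Forgetting orientation is two-to-one: symmetry puts both orientations in each fibre, and
  the absence of loops keeps them distinct.\<close>

lemma card_parcs:
  assumes "pair_graph G"
  shows "card (parcs G) = 2 * edge_count G"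
proof -
  interpret pair_graph G by fact
  let ?g = "\<lambda>(u, v). {u, v}"
  have edges: "edge_set G = ?g ` parcs G" by (auto simp: edge_set_def image_iff)
  have "card {p \<in> parcs G. ?g p = e} = 2" if e: "e \<in> edge_set G" for e
  proof -
    from e obtain u v where uv: "(u, v) \<in> parcs G" "e = {u, v}" by (auto simp: edge_set_def)
    have "{p \<in> parcs G. ?g p = e} = {(u, v), (v, u)}"
      using uv pair_graph_arc_sym[OF assms] by (auto simp: doubleton_eq_iff)
    moreover have "u \<noteq> v" using pair_no_loops[OF uv(1)] by simp
    ultimately show ?thesis by simp
  qed
  then show ?thesis
    using sum.image_gen[OF pair_finite_arcs, of "\<lambda>_. 1::nat" ?g]
    by (simp add: edges edge_count_def)
qed

text \<open>The entries are 0 or 1, so the squared norm counts arcs; the labeling only reindexes the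
  count.\<close>

lemma frobenius_norm_adj_matrix:
  assumes G: "pair_graph G" and s: "vertex_labeling G \<sigma>"
  shows "frobenius_norm (adj_matrix G \<sigma>) = sqrt (real (card (parcs G)))"
proof -
  interpret pair_graph G by fact
  let ?i = "inv_into (pverts G) \<sigma>"
  have b: "bij_betw ?i {..<order_of G} (pverts G)"
    using s bij_betw_inv_into by (auto simp: vertex_labeling_def atLeast0LessThan)
  have "(\<Sum>x<order_of G. \<Sum>y<order_of G. (cmod (adj_matrix G \<sigma> $$ (x, y)))\<^sup>2)
      = (\<Sum>x<order_of G. \<Sum>y<order_of G. if (?i x, ?i y) \<in> parcs G then 1 else 0)"
    by (intro sum.cong) (auto simp: adj_matrix_def)
  also have "\<dots> = (\<Sum>x<order_of G. \<Sum>v\<in>pverts G. if (?i x, v) \<in> parcs G then 1 else 0)"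
    by (intro sum.cong refl sum.reindex_bij_betw[OF b])
  also have "\<dots> = (\<Sum>u\<in>pverts G. \<Sum>v\<in>pverts G. if (u, v) \<in> parcs G then 1 else 0)"
    by (rule sum.reindex_bij_betw[OF b, of "\<lambda>u. \<Sum>v\<in>pverts G. if (u, v) \<in> parcs G then 1 else 0"])
  also have "\<dots> = (\<Sum>p\<in>pverts G \<times> pverts G. if p \<in> parcs G then 1 else 0)"
    by (simp add: sum.cartesian_product case_prod_unfold)
  also have "\<dots> = (\<Sum>p\<in>(pverts G \<times> pverts G) \<inter> parcs G. 1)"
    by (rule sum.inter_restrict[symmetric]) (simp add: pair_finite_verts)
  also have "(pverts G \<times> pverts G) \<inter> parcs G = parcs G"
    using parcs_subset[OF G] by blast
  finally show ?thesis by (simp add: frobenius_norm_def adj_matrix_def)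
qed

text \<open>The energy is the same for every labeling, so this bounds all labelings at once. Without
  edges both sides are \<open>0\<close>, since division by zero gives \<open>0\<close>.\<close>

lemma fourier_ratio_ge:
  assumes G: "pair_graph G" and ne: "pverts G \<noteq> {}" and s: "vertex_labeling G \<sigma>"
  shows "graph_energy G / sqrt (2 * real (edge_count G)) \<le> fourier_ratio (adj_matrix G \<sigma>)"
proof -
  interpret pair_graph G by fact
  let ?A = "adj_matrix G \<sigma>"
  have "0 < order_of G" using ne pair_finite_verts by (simp add: order_of_def card_gt_0_iff)
  then have F: "unitary_mat (order_of G) (fourier_matrix (order_of G))"
    by (rule unitary_fourier_matrix)
  have "fourier_ratio ?A = entry_l1_norm (fourier_matrix (order_of G) * ?A * fourier_matrix (order_of G))
      / sqrt (2 * real (edge_count G))"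
    using frobenius_norm_unitary[OF adj_matrix_carrier F] frobenius_norm_adj_matrix[OF G s] card_parcs[OF G]
    by (simp add: fourier_ratio_def adj_matrix_def Let_def)
  then show ?thesis
    using energy_le_entry_l1_norm[OF adj_matrix_carrier adj_matrix_hermitian[OF G] F, of \<sigma>]
    by (simp add: graph_energy_eq[OF s] divide_right_mono)
qed

section \<open>The join\<close>

text \<open>The four pieces of the arc set are disjoint, so arcs are counted first and the factor
  two of \<open>card_parcs\<close> is removed at the end.\<close>

lemma edge_count_join:
  assumes G: "pair_graph G" and H: "pair_graph H" and disj: "pverts G \<inter> pverts H = {}"
  shows "edge_count (graph_join G H) = edge_count G + edge_count H + order_of G * order_of H"
proof -
  interpret G: pair_graph G by fact
  interpret H: pair_graph H by fact
  note sub = parcs_subset[OF G] parcs_subset[OF H]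
  have "card (parcs (graph_join G H)) = card (parcs G \<union> parcs H \<union> pverts G \<times> pverts H)
      + card (pverts H \<times> pverts G)"
    unfolding graph_join_def pair_pre_digraph.simps
    by (rule card_Un_disjoint) (use sub disj in auto)
  also have "card (parcs G \<union> parcs H \<union> pverts G \<times> pverts H)
      = card (parcs G \<union> parcs H) + card (pverts G \<times> pverts H)"
    by (rule card_Un_disjoint) (use sub disj in auto)
  also have "card (parcs G \<union> parcs H) = card (parcs G) + card (parcs H)"
    by (rule card_Un_disjoint) (use sub disj in auto)
  finally show ?thesis
    using card_parcs[OF G] card_parcs[OF H] card_parcs[OF pair_graph_join[OF G H disj]]
    by (simp add: order_of_def card_cartesian_product)
qed

lemma order_of_join:
  assumes "pair_graph G" "pair_graph H" "pverts G \<inter> pverts H = {}"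
  shows "order_of (graph_join G H) = order_of G + order_of H"
proof -
  interpret G: pair_graph G by fact
  interpret H: pair_graph H by fact
  show ?thesis using assms(3) by (simp add: order_of_def graph_join_def card_Un_disjoint)
qed

text \<open>Placing \<open>H\<close> after \<open>G\<close> gives the adjacency matrix of the join
  the block form of \<open>adj_matrix_join\<close>.\<close>

definition join_labeling ::
  "'a pair_pre_digraph \<Rightarrow> ('a \<Rightarrow> nat) \<Rightarrow> ('a \<Rightarrow> nat) \<Rightarrow> 'a \<Rightarrow> nat" where
  "join_labeling G g h v = (if v \<in> pverts G then g v else order_of G + h v)"

lemma join_labeling:
  assumes G: "pair_graph G" and H: "pair_graph H" and disj: "pverts G \<inter> pverts H = {}"
    and g: "vertex_labeling G g" and h: "vertex_labeling H h"
  shows "vertex_labeling (graph_join G H) (join_labeling G g h)"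
proof -
  let ?s = "join_labeling G g h"
  have "bij_betw ?s (pverts G) {0..<order_of G}"
    using g unfolding vertex_labeling_def
    by (rule bij_betw_cong[THEN iffD1, rotated]) (simp add: join_labeling_def)
  moreover have "bij_betw ((+) (order_of G) \<circ> h) (pverts H) {order_of G..<order_of G + order_of H}"
    using h unfolding vertex_labeling_def
    by (rule bij_betw_trans) (auto simp: bij_betw_def image_add_atLeastLessThan)
  then have "bij_betw ?s (pverts H) {order_of G..<order_of G + order_of H}"
    by (rule bij_betw_cong[THEN iffD1, rotated]) (use disj in \<open>auto simp: join_labeling_def\<close>)
  ultimately have "bij_betw ?s (pverts G \<union> pverts H) ({0..<order_of G} \<union> {order_of G..<order_of G + order_of H})"
    by (rule bij_betw_combine) auto
  then show ?thesis
    using order_of_join[OF G H disj]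
    by (simp add: vertex_labeling_def graph_join_def ivl_disj_un_two)
qed

text \<open>The inverse labeling splits into the inverse of \<open>g\<close> and a shifted inverse
  of \<open>h\<close>. Disjointness ensures that the join adds no arcs inside the diagonal
  blocks.\<close>

lemma adj_matrix_join:
  assumes G: "pair_graph G" and H: "pair_graph H" and disj: "pverts G \<inter> pverts H = {}"
    and g: "vertex_labeling G g" and h: "vertex_labeling H h"
  shows "adj_matrix (graph_join G H) (join_labeling G g h)
    = four_block_mat (adj_matrix G g) (mat (order_of G) (order_of H) (\<lambda>_. 1))
        (mat (order_of H) (order_of G) (\<lambda>_. 1)) (adj_matrix H h)"
    (is "adj_matrix ?J ?s = ?R")
proof (rule eq_matI)
  let ?i = "inv_into (pverts ?J) ?s"
  let ?ig = "inv_into (pverts G) g" and ?ih = "inv_into (pverts H) h"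
  have inj: "inj_on ?s (pverts ?J)"
    using join_labeling[OF G H disj g h] by (simp add: vertex_labeling_def bij_betw_def)
  have ig: "?ig x \<in> pverts G" "g (?ig x) = x" if "x < order_of G" for x
    using g that by (auto simp: vertex_labeling_def bij_betw_def intro: inv_into_into f_inv_into_f)
  have ih: "?ih x \<in> pverts H" "h (?ih x) = x" if "x < order_of H" for x
    using h that by (auto simp: vertex_labeling_def bij_betw_def intro: inv_into_into f_inv_into_f)
  have iG: "?i x = ?ig x" if "x < order_of G" for x
    using ig[OF that] by (intro inv_into_f_eq[OF inj]) (auto simp: graph_join_def join_labeling_def)
  have iH: "?i x = ?ih (x - order_of G)" if "x < order_of G + order_of H" "\<not> x < order_of G" for x
    using ih[of "x - order_of G"] that disj
    by (intro inv_into_f_eq[OF inj]) (auto simp: graph_join_def join_labeling_def)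
  fix x y assume "x < dim_row ?R" "y < dim_col ?R"
  then have xy: "x < order_of G + order_of H" "y < order_of G + order_of H"
    by (auto simp: adj_matrix_def)
  have vG: "?i z \<in> pverts G" if "z < order_of G" for z
    using ig iG that by simp
  have vH: "?i z \<in> pverts H" if "z < order_of G + order_of H" "\<not> z < order_of G" for z
    using ih[of "z - order_of G"] iH[OF that] that by simp
  note sub = parcs_subset[OF G] parcs_subset[OF H]
  have L: "adj_matrix ?J ?s $$ (x, y) = (if (?i x, ?i y) \<in> parcs ?J then 1 else 0)"
    using xy order_of_join[OF G H disj] by (simp add: adj_matrix_def)
  have GG: "(u, v) \<in> parcs ?J \<longleftrightarrow> (u, v) \<in> parcs G" if "u \<in> pverts G" "v \<in> pverts G" for u v
    using that sub disj by (auto simp: graph_join_def)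
  have HH: "(u, v) \<in> parcs ?J \<longleftrightarrow> (u, v) \<in> parcs H" if "u \<in> pverts H" "v \<in> pverts H" for u v
    using that sub disj by (auto simp: graph_join_def)
  have GH: "(u, v) \<in> parcs ?J" "(v, u) \<in> parcs ?J" if "u \<in> pverts G" "v \<in> pverts H" for u v
    using that by (auto simp: graph_join_def)
  consider "x < order_of G" "y < order_of G" | "x < order_of G" "\<not> y < order_of G"
    | "\<not> x < order_of G" "y < order_of G" | "\<not> x < order_of G" "\<not> y < order_of G" by blast
  then show "adj_matrix ?J ?s $$ (x, y) = ?R $$ (x, y)"
  proof cases
    case 1
    then show ?thesis using xy GG[OF vG vG, of x y] by (simp add: L iG) (simp add: adj_matrix_def)
  next
    case 2
    then show ?thesis using xy GH(1)[OF vG vH, of x y] by (simp add: L) (simp add: adj_matrix_def)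
  next
    case 3
    then show ?thesis using xy GH(2)[OF vG vH, of y x] by (simp add: L) (simp add: adj_matrix_def)
  next
    case 4
    then show ?thesis using xy HH[OF vH vH, of x y] by (simp add: L iH) (simp add: adj_matrix_def)
  qed
qed (use order_of_join[OF G H disj] in \<open>auto simp: adj_matrix_def\<close>)

section \<open>Comparison of the join with the disjoint union\<close>

text \<open>The two matrices differ by ones exactly on the off-diagonal blocks, so the traces differ
  by the sums of the two off-diagonal blocks of \<open>U\<close>.\<close>

lemma mat_trace_ones_block_le:
  assumes A: "A \<in> carrier_mat m m" and B: "B \<in> carrier_mat n n" and U: "unitary_mat (m + n) U"
  shows "cmod (mat_trace (U * four_block_mat A (mat m n (\<lambda>_. 1)) (mat n m (\<lambda>_. 1)) B)
    - mat_trace (U * four_block_mat A (0\<^sub>m m n) (0\<^sub>m n m) B)) \<le> 2 * sqrt (real m * real n)"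
    (is "cmod (mat_trace (U * ?X) - mat_trace (U * ?Y)) \<le> _")
proof -
  let ?I = "{..<m}" and ?J = "{m..<m + n}"
  have UC: "U \<in> carrier_mat (m + n) (m + n)" using U by (simp add: unitary_mat_def)
  have XY: "?X \<in> carrier_mat (m + n) (m + n)" "?Y \<in> carrier_mat (m + n) (m + n)" using A B by auto
  have IJ: "{..<m + n} = ?I \<union> ?J" "?I \<inter> ?J = {}" by auto
  have "mat_trace (U * ?X) - mat_trace (U * ?Y)
      = (\<Sum>i<m + n. \<Sum>j<m + n. U $$ (i, j) * (?X $$ (j, i) - ?Y $$ (j, i)))"
    unfolding mat_trace_mult[OF UC XY(1)] mat_trace_mult[OF UC XY(2)]
    by (simp add: sum_subtractf right_diff_distrib)
  \<comment> \<open>The boolean equation says that both indices lie in the same diagonal block,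
    where the matrices agree.\<close>
  also have "\<dots> = (\<Sum>i<m + n. \<Sum>j<m + n. if (i < m) = (j < m) then 0 else U $$ (i, j))"
    using A B by (intro sum.cong) auto
  also have "\<dots> = (\<Sum>i\<in>?I. \<Sum>j\<in>?J. U $$ (i, j)) + (\<Sum>i\<in>?J. \<Sum>j\<in>?I. U $$ (i, j))"
    unfolding IJ(1) by (simp add: sum.union_disjoint IJ(2))
  also have "cmod \<dots> \<le> cmod (\<Sum>i\<in>?I. \<Sum>j\<in>?J. U $$ (i, j)) + cmod (\<Sum>i\<in>?J. \<Sum>j\<in>?I. U $$ (i, j))"
    by (rule norm_triangle_ineq)
  also have "\<dots> \<le> sqrt (real m * real n) + sqrt (real n * real m)"
    using unitary_mat_block_sum_le[OF U, of ?I ?J] unitary_mat_block_sum_le[OF U, of ?J ?I]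
    by (intro add_mono) (auto simp: subset_iff)
  finally show ?thesis by (simp add: mult.commute)
qed

text \<open>The characteristic polynomial of a block diagonal matrix is the product of those of its
  blocks, so the root lists are concatenated.\<close>

lemma matrix_energy_diag_block:
  assumes A: "A \<in> carrier_mat m m" and B: "B \<in> carrier_mat n n"
  shows "matrix_energy (four_block_mat A (0\<^sub>m m n) (0\<^sub>m n m) B) = matrix_energy A + matrix_energy B"
proof -
  from char_poly_factorized[OF A] obtain as where as: "char_poly A = (\<Prod>a\<leftarrow>as. [:- a, 1:])" by blast
  from char_poly_factorized[OF B] obtain bs where bs: "char_poly B = (\<Prod>a\<leftarrow>bs. [:- a, 1:])" by blast
  have "char_poly (four_block_mat A (0\<^sub>m m n) (0\<^sub>m n m) B) = char_poly A * char_poly B"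
    by (rule char_poly_0_block[OF refl _ _ A _ B]) (use as bs in auto)
  also have "\<dots> = (\<Prod>a\<leftarrow>as @ bs. [:- a, 1:])" by (simp add: as bs)
  finally have "matrix_energy (four_block_mat A (0\<^sub>m m n) (0\<^sub>m n m) B) = (\<Sum>e\<leftarrow>as @ bs. cmod e)"
    using A B by (intro matrix_energy_factorized[of _ "m + n"]) auto
  then show ?thesis by (simp add: matrix_energy_factorized[OF A as] matrix_energy_factorized[OF B bs])
qed

theorem proposition3p12:
  fixes G H :: "'a pair_pre_digraph"
    and N1 N2 sG sH :: nat
  assumes "pair_graph G" and "pair_graph H"
    and "pverts G \<noteq> {}" and "pverts H \<noteq> {}"
    and "pverts G \<inter> pverts H = {}"
    and "N1 = order_of G" and "N2 = order_of H"
    and "sG = edge_count G" and "sH = edge_count H"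
  shows "graph_energy G + graph_energy H - 2 * sqrt (real N1 * real N2)
           \<le> graph_energy (graph_join G H)
       \<and> graph_energy (graph_join G H)
           \<le> graph_energy G + graph_energy H + 2 * sqrt (real N1 * real N2)
       \<and> FR_min (graph_join G H)
           \<ge> max 0 (graph_energy G + graph_energy H - 2 * sqrt (real N1 * real N2))
               / sqrt (2 * (real sG + real sH + real N1 * real N2))"
proof -
  note G = assms(1) and H = assms(2) and disj = assms(5)
  let ?J = "graph_join G H"
  have J: "pair_graph ?J" by (rule pair_graph_join[OF G H disj])
  interpret G: pair_graph G by (rule G)
  interpret H: pair_graph H by (rule H)
  interpret J: pair_graph ?J by (rule J)
  obtain g h where g: "vertex_labeling G g" and h: "vertex_labeling H h"
    using vertex_labeling_exists G.pair_finite_verts H.pair_finite_verts by metis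
  define A B where "A = adj_matrix G g" and "B = adj_matrix H h"
  have A: "A \<in> carrier_mat N1 N1" "mat_adjoint A = A"
    and B: "B \<in> carrier_mat N2 N2" "mat_adjoint B = B"
    using assms(6,7) adj_matrix_hermitian[OF G] adj_matrix_hermitian[OF H] by (simp_all add: A_def B_def)
  define X where "X = four_block_mat A (mat N1 N2 (\<lambda>_. 1)) (mat N2 N1 (\<lambda>_. 1)) B"
  \<comment> \<open>The adjacency matrix of the disjoint union in the same vertex order; its energy
    is the sum of the two energies.\<close>
  define Y where "Y = four_block_mat A (0\<^sub>m N1 N2) (0\<^sub>m N2 N1) B"
  have X_adj: "X = adj_matrix ?J (join_labeling G g h)"
    unfolding X_def A_def B_def assms(6,7) by (rule adj_matrix_join[OF G H disj g h, symmetric])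
  have X: "X \<in> carrier_mat (N1 + N2) (N1 + N2)" "mat_adjoint X = X"
    by (use A B in \<open>simp add: X_def\<close>) (simp add: X_adj adj_matrix_hermitian[OF J])
  have "mat_adjoint Y = Y"
    using A B unfolding Y_def by (subst mat_adjoint_four_block[of _ N1 _ N2]) auto
  then have Y: "Y \<in> carrier_mat (N1 + N2) (N1 + N2)" "mat_adjoint Y = Y"
    using A B by (auto simp: Y_def)
  have eX: "matrix_energy X = graph_energy ?J"
    unfolding X_adj by (rule graph_energy_eq[OF join_labeling[OF G H disj g h], symmetric])
  have eY: "matrix_energy Y = graph_energy G + graph_energy H"
    unfolding Y_def matrix_energy_diag_block[OF A(1) B(1)]
    by (simp add: A_def B_def graph_energy_eq[OF g] graph_energy_eq[OF h])
  note close = mat_trace_ones_block_le[OF A(1) B(1), folded X_def Y_def]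
  have upper: "graph_energy ?J \<le> graph_energy G + graph_energy H + 2 * sqrt (real N1 * real N2)"
    using matrix_energy_perturb[OF X Y close] by (simp add: eX eY)
  \<comment> \<open>The trace estimate is symmetric in the two matrices, so exchanging them gives
    the lower bound.\<close>
  have "matrix_energy Y \<le> matrix_energy X + 2 * sqrt (real N1 * real N2)"
    by (rule matrix_energy_perturb[OF Y X]) (subst norm_minus_commute, rule close)
  then have lower: "graph_energy G + graph_energy H - 2 * sqrt (real N1 * real N2) \<le> graph_energy ?J"
    by (simp add: eX eY)
  \<comment> \<open>The minimum is attained, so a bound valid for every labeling applies to
    it.\<close>
  have "FR_min ?J \<in> {fourier_ratio (adj_matrix ?J \<sigma>) | \<sigma>. vertex_labeling ?J \<sigma>}"
    unfolding FR_min_def by (rule Min_in[OF FR_min_attained[OF J.pair_finite_verts]])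
  then obtain \<sigma> where s: "vertex_labeling ?J \<sigma>" "FR_min ?J = fourier_ratio (adj_matrix ?J \<sigma>)" by blast
  \<comment> \<open>The \<open>0\<close> in the maximum is covered by the energy being
    nonnegative.\<close>
  have "max 0 (graph_energy G + graph_energy H - 2 * sqrt (real N1 * real N2)) \<le> graph_energy ?J"
    using lower matrix_energy_nonneg[of X] by (simp add: eX)
  then have "max 0 (graph_energy G + graph_energy H - 2 * sqrt (real N1 * real N2))
        / sqrt (2 * (real sG + real sH + real N1 * real N2))
      \<le> graph_energy ?J / sqrt (2 * real (edge_count ?J))"
    by (simp add: edge_count_join[OF G H disj] assms(6-9) divide_right_mono)
  also have "\<dots> \<le> FR_min ?J"
    unfolding s(2) by (rule fourier_ratio_ge[OF J _ s(1)]) (use assms(3) in \<open>simp add: graph_join_def\<close>)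
  finally show ?thesis using lower upper by blast
qed

end
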